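(* For every integer $k \geq 1$, every $\alpha \in B$ and all $\beta_1,\dots,\beta_k \in B$, $$\alpha \neq ((\cdots((\alpha * \beta_1) * \beta_2) * \cdots ) * \beta_{k-1}) * \beta_k .$$
   Context: Let $F$ be the free group on free generators $x_1,x_2,x_3,\dots$. For each $i\ge 1$ let $\sigma_i$ be the automorphism of $F$ determined by $\sigma_i(x_i)=x_i x_{i+1} x_i^{-1}$, $\sigma_i(x_{i+1})=x_i$, and $\sigma_i(x_j)=x_j$ for $j\neq i,i+1$. Let $B$ be the group of automorphisms of $F$ generated by $\{\sigma_1,\sigma_2,\sigma_3,\dots\}$, with composition as multiplication: $(\alpha\beta)(x)=\alpha(\beta(x))$. The shift $s: B\to B$ is the group homomorphism given by $s(\sigma_i)=\sigma_{i+1}$, $s(\sigma_i^{-1})=\sigma_{i+1}^{-1}$, $s(\xi\cdot\eta)=s(\xi)\cdot s(\eta)$. For $\alpha,\beta\in B$ define $$\alpha * \beta = \alpha\cdot s(\beta)\cdot\sigma_1\cdot s(\alpha^{-1}).$$ *)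

theory Defs
  imports "HOL-Algebra.Bij" "HOL-Algebra.Generated_Groups"
begin

section \<open>Free groups\<close>

text \<open>
  The letter \<open>(x, True)\<close> stands for the generator \<open>x\<close> and \<open>(x, False)\<close> for its inverse.
  Elements of the free group are the freely reduced words.
\<close>

definition letter_inv :: "'a \<times> bool \<Rightarrow> 'a \<times> bool" where
  "letter_inv a = (fst a, \<not> snd a)"

fun cons_red :: "'a \<times> bool \<Rightarrow> ('a \<times> bool) list \<Rightarrow> ('a \<times> bool) list" where
  "cons_red a [] = [a]"
| "cons_red a (b # w) = (if b = letter_inv a then w else a # b # w)"

definition reduced :: "('a \<times> bool) list \<Rightarrow> bool" where
  "reduced w \<longleftrightarrow> successively (\<lambda>a b. b \<noteq> letter_inv a) w"

definition free_group :: "'a set \<Rightarrow> ('a \<times> bool) list monoid" where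
  "free_group X =
    \<lparr>carrier = {w. fst ` set w \<subseteq> X \<and> reduced w},
     mult = (\<lambda>u v. foldr cons_red u v),
     one = []\<rparr>"

definition free_gen :: "'a \<Rightarrow> ('a \<times> bool) list" where
  "free_gen x = [(x, True)]"

definition free_lift :: "('b, 'c) monoid_scheme \<Rightarrow> ('a \<Rightarrow> 'b) \<Rightarrow> ('a \<times> bool) list \<Rightarrow> 'b" where
  "free_lift G f w =
    foldr (\<lambda>(x, b) g. (if b then f x else inv\<^bsub>G\<^esub> (f x)) \<otimes>\<^bsub>G\<^esub> g) w \<one>\<^bsub>G\<^esub>"

lemma letter_inv_letter_inv [simp]: "letter_inv (letter_inv a) = a"
  by (simp add: letter_inv_def)

lemma fst_letter_inv [simp]: "fst (letter_inv a) = fst a"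
  by (simp add: letter_inv_def)

lemma letter_inv_neq [simp]: "letter_inv a \<noteq> a" "a \<noteq> letter_inv a"
  by (auto simp: letter_inv_def prod_eq_iff)

lemma letter_inv_eq_iff [simp]: "letter_inv a = letter_inv b \<longleftrightarrow> a = b"
  by (metis letter_inv_letter_inv)

lemma reduced_Nil [simp]: "reduced []"
  by (simp add: reduced_def)

lemma reduced_single [simp]: "reduced [a]"
  by (simp add: reduced_def)

lemma reduced_Cons: "reduced (a # w) \<longleftrightarrow> (w = [] \<or> hd w \<noteq> letter_inv a) \<and> reduced w"
  by (auto simp: reduced_def successively_Cons)

lemma reduced_cons_red: "reduced w \<Longrightarrow> reduced (cons_red a w)"
  by (cases w) (auto simp: reduced_Cons)

lemma cons_red_cancel: "reduced w \<Longrightarrow> cons_red a (cons_red (letter_inv a) w) = w"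
  by (cases w; cases "tl w") (auto simp: reduced_Cons)

lemma cons_red_reduced: "reduced (a # w) \<Longrightarrow> cons_red a w = a # w"
  by (cases w) (auto simp: reduced_Cons)

lemma reduced_foldr: "reduced v \<Longrightarrow> reduced (foldr cons_red u v)"
  by (induction u) (auto intro: reduced_cons_red)

lemma foldr_cons_red_assoc:
  assumes "reduced w"
  shows "foldr cons_red (foldr cons_red u v) w = foldr cons_red u (foldr cons_red v w)"
proof (induction u)
  case (Cons a u)
  define y where "y = foldr cons_red u v"
  have "foldr cons_red (cons_red a y) w = cons_red a (foldr cons_red y w)"
  proof (cases y)
    case (Cons b z)
    show ?thesis
    proof (cases "b = letter_inv a")
      case True
      then show ?thesis
        using Cons cons_red_cancel[OF reduced_foldr[OF assms]] by simp
    qed (simp add: Cons)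
  qed simp
  then show ?case using Cons by (simp add: y_def)
qed simp

lemma foldr_cons_red_Nil: "reduced u \<Longrightarrow> foldr cons_red u [] = u"
  by (induction u) (auto simp: cons_red_reduced reduced_Cons)

lemma letters_cons_red: "fst ` set (cons_red a w) \<subseteq> insert (fst a) (fst ` set w)"
  by (cases w) auto

lemma letters_foldr: "fst ` set (foldr cons_red u v) \<subseteq> fst ` set u \<union> fst ` set v"
proof (induction u)
  case (Cons a u)
  then show ?case using letters_cons_red[of a "foldr cons_red u v"] by simp blast
qed simp

lemma foldr_cons_red_inverse: "foldr cons_red (map letter_inv (rev u)) u = []"
proof -
  have "foldr cons_red (map letter_inv (rev u)) (u @ v) = v" for v
    by (induction u arbitrary: v) auto
  from this[of "[]"] show ?thesis by simp
qed

lemma reduced_inverse: "reduced u \<Longrightarrow> reduced (map letter_inv (rev u))"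
  unfolding reduced_def successively_map successively_rev
  by (erule successively_mono) auto

theorem group_free_group: "group (free_group X)"
proof (rule groupI, goal_cases)
  case (1 u v)
  then show ?case
    using subset_trans[OF letters_foldr[of u v]] reduced_foldr[of v u] by (simp add: free_group_def)
next
  case (5 u)
  then show ?case
    using foldr_cons_red_inverse[of u] reduced_inverse[of u]
    by (intro bexI[of _ "map letter_inv (rev u)"]) (auto simp: free_group_def image_subset_iff)
qed (auto simp: free_group_def foldr_cons_red_assoc)

lemma free_gen_closed [simp]: "x \<in> X \<Longrightarrow> free_gen x \<in> carrier (free_group X)"
  by (simp add: free_gen_def free_group_def)

lemma inv_free_gen: "x \<in> X \<Longrightarrow> inv\<^bsub>free_group X\<^esub> (free_gen x) = [(x, False)]"
  by (rule group.inv_equality[OF group_free_group])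
     (auto simp: free_gen_def free_group_def letter_inv_def)

lemma free_group_induct [consumes 1, case_names one gen inv]:
  assumes "w \<in> carrier (free_group X)"
    and "P \<one>\<^bsub>free_group X\<^esub>"
    and gen: "\<And>x w. x \<in> X \<Longrightarrow> w \<in> carrier (free_group X) \<Longrightarrow> P w
           \<Longrightarrow> P (free_gen x \<otimes>\<^bsub>free_group X\<^esub> w)"
    and inv: "\<And>x w. x \<in> X \<Longrightarrow> w \<in> carrier (free_group X) \<Longrightarrow> P w
           \<Longrightarrow> P (inv\<^bsub>free_group X\<^esub> (free_gen x) \<otimes>\<^bsub>free_group X\<^esub> w)"
  shows "P w"
  using assms(1)
proof (induction w)
  case Nil
  then show ?case using assms(2) by (simp add: free_group_def)
next
  case (Cons a w)
  then have w: "w \<in> carrier (free_group X)" "P w" and a: "fst a \<in> X"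
    by (auto simp: free_group_def reduced_Cons)
  have "a # w = [a] \<otimes>\<^bsub>free_group X\<^esub> w"
    using Cons.prems by (simp add: free_group_def cons_red_reduced)
  moreover have "[a] = free_gen (fst a) \<or> [a] = inv\<^bsub>free_group X\<^esub> (free_gen (fst a))"
    using a by (cases a) (auto simp: free_gen_def inv_free_gen[unfolded free_gen_def])
  ultimately show ?case using gen[OF a w] inv[OF a w] by auto
qed

theorem free_lift_hom:
  assumes G: "group G" and f: "\<And>x. x \<in> X \<Longrightarrow> f x \<in> carrier G"
  shows "free_lift G f \<in> hom (free_group X) G"
proof -
  interpret G: group G by fact
  define l where "l = (\<lambda>(x, b). if b then f x else inv\<^bsub>G\<^esub> (f x))"
  have l: "l a \<in> carrier G" if "fst a \<in> X" for a
    using f that by (auto simp: l_def split: prod.splits)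
  have l_inv: "l (letter_inv a) = inv\<^bsub>G\<^esub> (l a)" if "fst a \<in> X" for a
    using f that by (auto simp: l_def letter_inv_def split: prod.splits)
  have Nil: "free_lift G f [] = \<one>\<^bsub>G\<^esub>" by (simp add: free_lift_def)
  have Cons: "free_lift G f (a # w) = l a \<otimes>\<^bsub>G\<^esub> free_lift G f w" for a w
    by (simp add: free_lift_def l_def split: prod.splits)
  have closed: "free_lift G f w \<in> carrier G" if "fst ` set w \<subseteq> X" for w
    using that by (induction w) (auto simp: Nil Cons l)
  have red: "free_lift G f (cons_red a w) = l a \<otimes>\<^bsub>G\<^esub> free_lift G f w"
    if "fst a \<in> X" "fst ` set w \<subseteq> X" for a w
  proof (cases w)
    case (Cons b z)
    show ?thesis
    proof (cases "b = letter_inv a")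
      case True
      then show ?thesis
        using that l l_inv closed[of z]
        by (simp add: Cons \<open>\<And>w a. free_lift G f (a # w) = _\<close> G.m_assoc[symmetric])
    qed (simp add: Cons \<open>\<And>w a. free_lift G f (a # w) = _\<close>)
  qed (simp add: Cons)
  have mult: "free_lift G f (foldr cons_red u v) = free_lift G f u \<otimes>\<^bsub>G\<^esub> free_lift G f v"
    if "fst ` set u \<subseteq> X" "fst ` set v \<subseteq> X" for u v
    using that(1)
  proof (induction u)
    case (Cons a u)
    have "fst ` set (foldr cons_red u v) \<subseteq> X"
      using Cons.prems that(2) by (intro subset_trans[OF letters_foldr[of u v]]) auto
    then show ?case
      using Cons closed[of u] closed[of v] that(2)
      by (simp add: red \<open>\<And>w a. free_lift G f (a # w) = _\<close> G.m_assoc l)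
  qed (simp add: Nil closed that)
  show ?thesis
    by (rule homI) (auto simp: free_group_def closed mult)
qed

lemma free_lift_gen: "group G \<Longrightarrow> f x \<in> carrier G \<Longrightarrow> free_lift G f (free_gen x) = f x"
  by (simp add: free_lift_def free_gen_def monoid.r_one group.is_monoid)

theorem free_group_hom_eq:
  assumes G: "group G" and gh: "g \<in> hom (free_group X) G" "h \<in> hom (free_group X) G"
    and eq: "\<And>x. x \<in> X \<Longrightarrow> g (free_gen x) = h (free_gen x)"
    and w: "w \<in> carrier (free_group X)"
  shows "g w = h w"
proof -
  interpret F: group "free_group X" by (rule group_free_group)
  interpret g: group_hom "free_group X" G g
    using G gh by (simp add: group_hom_def group_hom_axioms_def group_free_group)
  interpret h: group_hom "free_group X" G h
    using G gh by (simp add: group_hom_def group_hom_axioms_def group_free_group)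
  from w show ?thesis
    by (induction rule: free_group_induct) (simp_all add: eq)
qed


section \<open>The braid group on infinitely many strands\<close>

text \<open>The generators are indexed by the positive natural numbers.\<close>

definition F :: "(nat \<times> bool) list monoid" where
  "F = free_group {1..}"

definition sigma :: "nat \<Rightarrow> (nat \<times> bool) list \<Rightarrow> (nat \<times> bool) list" where
  "sigma i = restrict
    (free_lift F (\<lambda>j.
      if j = i then free_gen i \<otimes>\<^bsub>F\<^esub> free_gen (i + 1) \<otimes>\<^bsub>F\<^esub> inv\<^bsub>F\<^esub> (free_gen i)
      else if j = i + 1 then free_gen i
      else free_gen j))
    (carrier F)"

definition B :: "((nat \<times> bool) list \<Rightarrow> (nat \<times> bool) list) monoid" where
  "B = subgroup_generated (AutoGroup F) (sigma ` {1..})"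

text \<open>
  Extensionality only fixes the values outside \<open>carrier B\<close>, so that the homomorphism is unique
  as a total function; see \<open>shift_ex1\<close> below.
\<close>

definition shift ::
  "((nat \<times> bool) list \<Rightarrow> (nat \<times> bool) list) \<Rightarrow> ((nat \<times> bool) list \<Rightarrow> (nat \<times> bool) list)" where
  "shift = (THE s. s \<in> hom B B \<and> s \<in> extensional (carrier B) \<and>
                   (\<forall>i\<ge>1. s (sigma i) = sigma (i + 1)))"

definition braid_star ::
  "((nat \<times> bool) list \<Rightarrow> (nat \<times> bool) list) \<Rightarrow> ((nat \<times> bool) list \<Rightarrow> (nat \<times> bool) list)
     \<Rightarrow> ((nat \<times> bool) list \<Rightarrow> (nat \<times> bool) list)" (infixl "\<star>" 70) where
  "\<alpha> \<star> \<beta> = \<alpha> \<otimes>\<^bsub>B\<^esub> shift \<beta> \<otimes>\<^bsub>B\<^esub> sigma 1 \<otimes>\<^bsub>B\<^esub> shift (inv\<^bsub>B\<^esub> \<alpha>)"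

interpretation F: group F
  unfolding F_def by (rule group_free_group)

interpretation A: group "AutoGroup F"
  by (rule F.AutoGroup)

lemma free_gen_F [simp]: "j \<ge> 1 \<Longrightarrow> free_gen j \<in> carrier F"
  by (simp add: F_def)

lemma free_lift_hom_F: "(\<And>j. j \<ge> 1 \<Longrightarrow> f j \<in> carrier F) \<Longrightarrow> free_lift F f \<in> hom F F"
  using free_lift_hom[OF F.is_group, of "{1..}" f] by (simp add: F_def)

lemma free_lift_gen_F: "f j \<in> carrier F \<Longrightarrow> free_lift F f (free_gen j) = f j"
  by (rule free_lift_gen[OF F.is_group])

lemma F_hom_eq:
  assumes "g \<in> hom F F" "h \<in> hom F F" "\<And>j. j \<ge> 1 \<Longrightarrow> g (free_gen j) = h (free_gen j)"
    and "w \<in> carrier F"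
  shows "g w = h w"
  using free_group_hom_eq[OF F.is_group, of g "{1..}" h w] assms by (simp add: F_def)

lemma carrier_AutoGroup: "carrier (AutoGroup F) = auto F"
  by (simp add: AutoGroup_def)

lemma mult_AutoGroup:
  "\<alpha> \<in> auto F \<Longrightarrow> \<beta> \<in> auto F \<Longrightarrow> \<alpha> \<otimes>\<^bsub>AutoGroup F\<^esub> \<beta> = compose (carrier F) \<alpha> \<beta>"
  by (simp add: AutoGroup_def BijGroup_def auto_def)

lemma one_AutoGroup: "\<one>\<^bsub>AutoGroup F\<^esub> = (\<lambda>w\<in>carrier F. w)"
  by (simp add: AutoGroup_def BijGroup_def)

lemma auto_hom: "\<alpha> \<in> auto F \<Longrightarrow> \<alpha> \<in> hom F F"
  by (simp add: auto_def)

lemma auto_ext: "\<alpha> \<in> auto F \<Longrightarrow> \<alpha> \<in> extensional (carrier F)"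
  by (simp add: auto_def Bij_def)

lemma auto_closed: "\<alpha> \<in> auto F \<Longrightarrow> w \<in> carrier F \<Longrightarrow> \<alpha> w \<in> carrier F"
  by (rule hom_in_carrier[OF auto_hom])

lemma restrict_hom: "h \<in> hom F F \<Longrightarrow> restrict h (carrier F) \<in> hom F F"
  using F.m_closed by (auto simp: hom_def simp del: F.m_closed)

lemma hom_F_eqI:
  assumes "g \<in> hom F F" "h \<in> hom F F" "g \<in> extensional (carrier F)" "h \<in> extensional (carrier F)"
    and "\<And>j. j \<ge> 1 \<Longrightarrow> g (free_gen j) = h (free_gen j)"
  shows "g = h"
  by (rule extensionalityI[OF assms(3,4)], rule F_hom_eq[OF assms(1,2)])
     (use assms(5) in auto)

lemma autoI:
  assumes g: "g \<in> hom F F" "g \<in> extensional (carrier F)" and h: "h \<in> hom F F"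
    and gh: "\<And>j. j \<ge> 1 \<Longrightarrow> g (h (free_gen j)) = free_gen j"
    and hg: "\<And>j. j \<ge> 1 \<Longrightarrow> h (g (free_gen j)) = free_gen j"
  shows "g \<in> auto F"
proof -
  have id: "(\<lambda>w. w) \<in> hom F F" by (simp add: hom_def)
  have "(g \<circ> h) w = w" if "w \<in> carrier F" for w
    by (rule F_hom_eq[OF Group.hom_compose[OF h g(1)] id _ that]) (simp add: gh)
  moreover have "(h \<circ> g) w = w" if "w \<in> carrier F" for w
    by (rule F_hom_eq[OF Group.hom_compose[OF g(1) h] id _ that]) (simp add: hg)
  ultimately have "bij_betw g (carrier F) (carrier F)"
    using g h by (intro bij_betw_byWitness[where f' = h]) (auto dest: hom_in_carrier)
  with g show ?thesis by (simp add: auto_def Bij_def)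
qed

lemma sigma_hom: "i \<ge> 1 \<Longrightarrow> sigma i \<in> hom F F"
  unfolding sigma_def by (rule restrict_hom, rule free_lift_hom_F) auto

lemma sigma_gen:
  assumes "i \<ge> 1"
  shows "sigma i (free_gen i) = free_gen i \<otimes>\<^bsub>F\<^esub> free_gen (i + 1) \<otimes>\<^bsub>F\<^esub> inv\<^bsub>F\<^esub> (free_gen i)"
    and "sigma i (free_gen (i + 1)) = free_gen i"
    and "j \<ge> 1 \<Longrightarrow> j \<noteq> i \<Longrightarrow> j \<noteq> i + 1 \<Longrightarrow> sigma i (free_gen j) = free_gen j"
  using assms by (auto simp: sigma_def free_lift_gen_F)

lemma sigma_auto:
  assumes i: "i \<ge> 1"
  shows "sigma i \<in> auto F"
proof -
  define f where "f = (\<lambda>j. if j = i then free_gen (i + 1)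
    else if j = i + 1 then inv\<^bsub>F\<^esub> (free_gen (i + 1)) \<otimes>\<^bsub>F\<^esub> free_gen i \<otimes>\<^bsub>F\<^esub> free_gen (i + 1)
    else free_gen j)"
  define t where "t = free_lift F f"
  have f: "f j \<in> carrier F" if "j \<ge> 1" for j
    using that i by (auto simp: f_def)
  have t: "t \<in> hom F F"
    unfolding t_def using f by (intro free_lift_hom_F) auto
  have tg: "t (free_gen j) = f j" if "j \<ge> 1" for j
    using f[OF that] by (simp add: t_def free_lift_gen_F)
  interpret s: group_hom F F "sigma i"
    by (simp add: group_hom_def group_hom_axioms_def sigma_hom[OF i])
  interpret t: group_hom F F t
    by (simp add: group_hom_def group_hom_axioms_def t)
  note sg = sigma_gen[OF i]
  have canc: "a \<otimes>\<^bsub>F\<^esub> (inv\<^bsub>F\<^esub> a \<otimes>\<^bsub>F\<^esub> b) = b" "inv\<^bsub>F\<^esub> a \<otimes>\<^bsub>F\<^esub> (a \<otimes>\<^bsub>F\<^esub> b) = b"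
    if "a \<in> carrier F" "b \<in> carrier F" for a b
    using that by (simp_all add: F.m_assoc[symmetric])
  have [simp]: "free_gen i \<in> carrier F" "free_gen (i + 1) \<in> carrier F" "free_gen (Suc i) \<in> carrier F"
    using i by auto
  show ?thesis
  proof (rule autoI[OF sigma_hom[OF i] _ t])
    show "sigma i \<in> extensional (carrier F)" by (simp add: sigma_def)
  next
    fix j :: nat assume j: "j \<ge> 1"
    consider "j = i" | "j = i + 1" | "j \<noteq> i" "j \<noteq> i + 1" by blast
    then show "sigma i (t (free_gen j)) = free_gen j"
      by cases (use j i sg in \<open>auto simp: tg f_def F.m_assoc canc\<close>)
    consider "j = i" | "j = i + 1" | "j \<noteq> i" "j \<noteq> i + 1" by blast
    then show "t (sigma i (free_gen j)) = free_gen j"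
      by cases (use j i sg in \<open>auto simp: tg f_def F.m_assoc canc\<close>)
  qed
qed

lemma carrier_B: "carrier B = generate (AutoGroup F) (sigma ` {1..})"
proof -
  have "sigma ` {1..} \<subseteq> carrier (AutoGroup F)"
    using sigma_auto by (auto simp: carrier_AutoGroup)
  then show ?thesis by (simp add: B_def carrier_subgroup_generated Int_absorb1)
qed

lemma group_B: "group B"
  unfolding B_def by (rule A.group_subgroup_generated)

lemma carrier_B_subset: "carrier B \<subseteq> auto F"
  unfolding B_def carrier_AutoGroup[symmetric] by (rule A.carrier_subgroup_generated_subset)

lemma sigma_in_B: "i \<ge> 1 \<Longrightarrow> sigma i \<in> carrier B"
  by (auto simp: carrier_B intro: generate.incl)

lemma mult_B_AutoGroup: "mult B = mult (AutoGroup F)"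
  by (simp add: B_def)

lemma mult_B: "\<alpha> \<in> carrier B \<Longrightarrow> \<beta> \<in> carrier B \<Longrightarrow> \<alpha> \<otimes>\<^bsub>B\<^esub> \<beta> = compose (carrier F) \<alpha> \<beta>"
  using carrier_B_subset mult_AutoGroup by (auto simp: mult_B_AutoGroup)

theorem B_hom_eq:
  assumes G: "group G" and gh: "g \<in> hom B G" "h \<in> hom B G"
    and eq: "\<And>i. i \<ge> 1 \<Longrightarrow> g (sigma i) = h (sigma i)" and \<alpha>: "\<alpha> \<in> carrier B"
  shows "g \<alpha> = h \<alpha>"
proof -
  interpret B: group B by (rule group_B)
  interpret g: group_hom B G g
    using G gh by (simp add: group_hom_def group_hom_axioms_def group_B)
  interpret h: group_hom B G h
    using G gh by (simp add: group_hom_def group_hom_axioms_def group_B)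
  have inv_B: "inv\<^bsub>B\<^esub> \<beta> = inv\<^bsub>AutoGroup F\<^esub> \<beta>" if "\<beta> \<in> carrier B" for \<beta>
    using that unfolding B_def by (rule A.inv_subgroup_generated)
  have mult: "\<beta> \<otimes>\<^bsub>B\<^esub> \<gamma> = \<beta> \<otimes>\<^bsub>AutoGroup F\<^esub> \<gamma>" and one_B: "\<one>\<^bsub>B\<^esub> = \<one>\<^bsub>AutoGroup F\<^esub>" for \<beta> \<gamma>
    by (simp_all add: B_def)
  from \<alpha> have "\<alpha> \<in> generate (AutoGroup F) (sigma ` {1..})" by (simp add: carrier_B)
  then have "\<alpha> \<in> carrier B \<and> g \<alpha> = h \<alpha>"
  proof induction
    case one
    then show ?case using g.hom_one h.hom_one B.one_closed unfolding one_B by simp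
  next
    case (incl \<beta>)
    then show ?case using eq sigma_in_B by auto
  next
    case (inv \<beta>)
    then obtain i where i: "i \<ge> 1" "\<beta> = sigma i" by auto
    then have \<beta>: "\<beta> \<in> carrier B" by (simp add: sigma_in_B)
    then have "g (inv\<^bsub>B\<^esub> \<beta>) = h (inv\<^bsub>B\<^esub> \<beta>)" using i eq by simp
    with B.inv_closed[OF \<beta>] show ?case unfolding inv_B[OF \<beta>] ..
  next
    case (eng \<beta> \<gamma>)
    then show ?case
      using g.hom_mult[of \<beta> \<gamma>] h.hom_mult[of \<beta> \<gamma>] B.m_closed[of \<beta> \<gamma>] by (simp add: mult)
  qed
  then show ?thesis ..
qed

text \<open>
  The shift is well defined because it is the restriction of an endomorphism of \<open>AutoGroup F\<close>.
\<close>

lemma shift_exists: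
  "\<exists>s. s \<in> hom B B \<and> s \<in> extensional (carrier B) \<and> (\<forall>i\<ge>1. s (sigma i) = sigma (i + 1))"
proof -
  define sh where "sh = free_lift F (\<lambda>j. free_gen (j + 1))"
  have sh: "sh \<in> hom F F" unfolding sh_def by (rule free_lift_hom_F) auto
  have sh_gen: "sh (free_gen j) = free_gen (j + 1)" for j
    by (simp add: sh_def free_lift_gen_F)
  interpret sh: group_hom F F sh
    by (simp add: group_hom_def group_hom_axioms_def sh)
  define f where "f = (\<lambda>\<alpha> (j::nat). if j = 1 then free_gen 1 else sh (\<alpha> (free_gen (j - 1))))"
  define S where "S = (\<lambda>\<alpha>. restrict (free_lift F (f \<alpha>)) (carrier F))"
  have f: "f \<alpha> j \<in> carrier F" if "\<alpha> \<in> auto F" "j \<ge> 1" for \<alpha> j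
    using that sh.hom_closed[OF auto_closed[OF that(1), of "free_gen (j - 1)"]]
    by (cases "j = 1") (simp_all add: f_def)
  have S: "S \<alpha> \<in> hom F F" if "\<alpha> \<in> auto F" for \<alpha>
    unfolding S_def using f[OF that] by (intro restrict_hom free_lift_hom_F) auto
  have S_ext: "S \<alpha> \<in> extensional (carrier F)" for \<alpha> by (simp add: S_def)
  have S_gen: "S \<alpha> (free_gen j) = f \<alpha> j" if "\<alpha> \<in> auto F" "j \<ge> 1" for \<alpha> j
    using f[OF that] that by (simp add: S_def free_lift_gen_F)
  have S_sh: "S \<alpha> (sh w) = sh (\<alpha> w)" if \<alpha>: "\<alpha> \<in> auto F" and w: "w \<in> carrier F" for \<alpha> w
  proof -
    have "(S \<alpha> \<circ> sh) w = (sh \<circ> \<alpha>) w"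
    proof (rule F_hom_eq[OF _ _ _ w])
      show "S \<alpha> \<circ> sh \<in> hom F F" using sh S[OF \<alpha>] by (rule Group.hom_compose)
      show "sh \<circ> \<alpha> \<in> hom F F" using auto_hom[OF \<alpha>] sh by (rule Group.hom_compose)
      show "(S \<alpha> \<circ> sh) (free_gen j) = (sh \<circ> \<alpha>) (free_gen j)" if "j \<ge> 1" for j
        using that \<alpha> by (simp add: sh_gen S_gen f_def)
    qed
    then show ?thesis by simp
  qed
  have SS_gen: "S \<alpha> (S \<beta> (free_gen j)) = f (\<alpha> \<otimes>\<^bsub>AutoGroup F\<^esub> \<beta>) j"
    if "\<alpha> \<in> auto F" "\<beta> \<in> auto F" "j \<ge> 1" for \<alpha> \<beta> j
  proof (cases "j = 1")
    case False
    with that have g: "free_gen (j - 1) \<in> carrier F" by auto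
    have "S \<alpha> (S \<beta> (free_gen j)) = S \<alpha> (sh (\<beta> (free_gen (j - 1))))"
      using that False by (simp add: S_gen f_def)
    also have "\<dots> = sh (\<alpha> (\<beta> (free_gen (j - 1))))"
      by (rule S_sh[OF that(1) auto_closed[OF that(2) g]])
    finally show ?thesis using that False g by (simp add: f_def mult_AutoGroup compose_eq)
  qed (use that in \<open>simp add: S_gen f_def\<close>)
  have f_one: "f \<one>\<^bsub>AutoGroup F\<^esub> j = free_gen j" if "j \<ge> 1" for j
    using that by (auto simp: f_def one_AutoGroup sh_gen)
  have S_auto: "S \<alpha> \<in> auto F" if \<alpha>: "\<alpha> \<in> auto F" for \<alpha>
  proof -
    have i: "inv\<^bsub>AutoGroup F\<^esub> \<alpha> \<in> auto F"
      using A.inv_closed \<alpha> by (simp add: carrier_AutoGroup)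
    show ?thesis
      by (rule autoI[OF S[OF \<alpha>] S_ext S[OF i]])
         (use \<alpha> i f_one in \<open>auto simp: SS_gen carrier_AutoGroup\<close>)
  qed
  have S_hom: "S \<in> hom (AutoGroup F) (AutoGroup F)"
  proof (rule homI)
    fix \<alpha> \<beta> assume ab: "\<alpha> \<in> carrier (AutoGroup F)" "\<beta> \<in> carrier (AutoGroup F)"
    then have ab': "\<alpha> \<in> auto F" "\<beta> \<in> auto F" "\<alpha> \<otimes>\<^bsub>AutoGroup F\<^esub> \<beta> \<in> auto F"
      using A.m_closed[OF ab] by (auto simp: carrier_AutoGroup)
    have SS: "S \<alpha> \<otimes>\<^bsub>AutoGroup F\<^esub> S \<beta> = compose (carrier F) (S \<alpha>) (S \<beta>)"
      using ab' by (simp add: mult_AutoGroup S_auto)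
    show "S (\<alpha> \<otimes>\<^bsub>AutoGroup F\<^esub> \<beta>) = S \<alpha> \<otimes>\<^bsub>AutoGroup F\<^esub> S \<beta>"
      unfolding SS
    proof (rule hom_F_eqI[OF S[OF ab'(3)] _ S_ext])
      show "compose (carrier F) (S \<alpha>) (S \<beta>) \<in> hom F F"
        using S ab' by (intro F.hom_compose) auto
      fix j :: nat assume "j \<ge> 1"
      with ab' show "S (\<alpha> \<otimes>\<^bsub>AutoGroup F\<^esub> \<beta>) (free_gen j)
          = compose (carrier F) (S \<alpha>) (S \<beta>) (free_gen j)"
        using SS_gen[of \<alpha> \<beta> j] S_gen[of "\<alpha> \<otimes>\<^bsub>AutoGroup F\<^esub> \<beta>" j]
        by (simp add: compose_eq del: One_nat_def)
    qed simp
  qed (simp add: carrier_AutoGroup S_auto)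
  have S_sigma: "S (sigma i) = sigma (i + 1)" if i: "i \<ge> 1" for i
  proof (rule hom_F_eqI[OF S[OF sigma_auto[OF i]] sigma_hom S_ext])
    fix j :: nat assume j: "j \<ge> 1"
    consider "j = 1" | "j = i + 1" | "j = i + 2" | "j \<noteq> 1" "j \<noteq> i + 1" "j \<noteq> i + 2" by blast
    then show "S (sigma i) (free_gen j) = sigma (i + 1) (free_gen j)"
    proof cases
      case 4
      then have "j - 1 \<ge> 1" "j - 1 \<noteq> i" "j - 1 \<noteq> i + 1" using j by auto
      then show ?thesis
        using 4 i j sigma_gen(3)[OF i, of "j - 1"] sigma_gen(3)[of "i + 1" j]
        by (simp add: S_gen sigma_auto f_def sh_gen)
    qed (use i j sigma_gen[OF i] sigma_gen[of "i + 1"] in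
           \<open>auto simp: S_gen sigma_auto f_def sh_gen\<close>)
  qed (use i in \<open>auto simp: sigma_def\<close>)
  interpret S: group_hom "AutoGroup F" "AutoGroup F" S
    by (simp add: group_hom_def group_hom_axioms_def S_hom)
  have "S ` carrier B = generate (AutoGroup F) (S ` sigma ` {1..})"
    unfolding carrier_B using sigma_auto
    by (intro S.generate_img[symmetric]) (auto simp: carrier_AutoGroup)
  also have "\<dots> \<subseteq> carrier B"
    unfolding carrier_B by (rule A.mono_generate) (auto simp: S_sigma)
  finally have SB: "S \<alpha> \<in> carrier B" if "\<alpha> \<in> carrier B" for \<alpha> using that by auto
  have "restrict S (carrier B) \<in> hom B B"
  proof (rule homI)
    fix \<alpha> \<beta> assume ab: "\<alpha> \<in> carrier B" "\<beta> \<in> carrier B"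
    then have "\<alpha> \<otimes>\<^bsub>B\<^esub> \<beta> \<in> carrier B"
      by (simp add: group.is_monoid[OF group_B] monoid.m_closed)
    then show "restrict S (carrier B) (\<alpha> \<otimes>\<^bsub>B\<^esub> \<beta>)
        = restrict S (carrier B) \<alpha> \<otimes>\<^bsub>B\<^esub> restrict S (carrier B) \<beta>"
      using ab S.hom_mult[of \<alpha> \<beta>] subsetD[OF carrier_B_subset]
      unfolding mult_B_AutoGroup carrier_AutoGroup by simp
  qed (simp add: SB)
  then show ?thesis
    using S_sigma sigma_in_B by (intro exI[of _ "restrict S (carrier B)"]) auto
qed

theorem shift_ex1:
  "\<exists>!s. s \<in> hom B B \<and> s \<in> extensional (carrier B) \<and> (\<forall>i\<ge>1. s (sigma i) = sigma (i + 1))"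
proof (rule ex_ex1I[OF shift_exists])
  fix s t
  assume "s \<in> hom B B \<and> s \<in> extensional (carrier B) \<and> (\<forall>i\<ge>1. s (sigma i) = sigma (i + 1))"
    and "t \<in> hom B B \<and> t \<in> extensional (carrier B) \<and> (\<forall>i\<ge>1. t (sigma i) = sigma (i + 1))"
  then have st: "s \<in> hom B B" "t \<in> hom B B" "s \<in> extensional (carrier B)" "t \<in> extensional (carrier B)"
    "\<forall>i\<ge>1. s (sigma i) = sigma (i + 1)" "\<forall>i\<ge>1. t (sigma i) = sigma (i + 1)"
    by blast+
  show "s = t"
    by (rule extensionalityI[OF st(3,4)], rule B_hom_eq[OF group_B st(1,2)]) (use st(5,6) in auto)
qed

lemma shift_props:
  "shift \<in> hom B B \<and> shift \<in> extensional (carrier B) \<and> (\<forall>i\<ge>1. shift (sigma i) = sigma (i + 1))"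
  unfolding shift_def by (rule theI'[OF shift_ex1])

theorem shift_hom: "shift \<in> hom B B"
  using shift_props by (rule conjunct1)

theorem shift_sigma: "i \<ge> 1 \<Longrightarrow> shift (sigma i) = sigma (i + 1)"
  using shift_props by blast

lemma shift_inv_sigma:
  assumes "i \<ge> 1"
  shows "shift (inv\<^bsub>B\<^esub> (sigma i)) = inv\<^bsub>B\<^esub> (sigma (i + 1))"
proof -
  interpret group_hom B B shift
    by (simp add: group_hom_def group_hom_axioms_def group_B shift_hom)
  show ?thesis using assms by (simp add: sigma_in_B shift_sigma)
qed

end

theory Submission
  imports Defs
begin

text \<open>
  The proof follows Larue. Since \<open>\<alpha> \<star> \<beta> = \<alpha> \<cdot> (s(\<beta>) \<sigma>\<^sub>1 s(\<alpha>\<inverse>))\<close>, an iterated right multiple of \<open>\<alpha>\<close> is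
  \<open>\<alpha> \<cdot> \<pi>\<close>, where \<open>\<pi>\<close> is a nonempty product of braids \<open>s(\<gamma>) \<sigma>\<^sub>1 s(\<delta>)\<close>. It remains to see that
  such a \<open>\<pi>\<close> is not the identity, and this is witnessed by \<open>x\<^sub>1\<inverse>\<close>. Let \<open>E\<close> be the set of reduced
  words that start with the letter \<open>x\<^sub>1\<close>. A shifted braid fixes \<open>x\<^sub>1\<inverse>\<close>, while \<open>\<sigma>\<^sub>1\<close> sends it to
  \<open>x\<^sub>1 x\<^sub>2\<inverse> x\<^sub>1\<inverse>\<close>, which lies in \<open>E\<close>. If \<open>\<sigma>\<^sub>1\<close> and all shifted braids map \<open>E\<close> into itself, then
  \<open>\<pi>(x\<^sub>1\<inverse>)\<close> lies in \<open>E\<close>, and \<open>x\<^sub>1\<inverse>\<close> does not.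

  That \<open>E\<close> is stable has the same reason in both cases (\<open>first_marker\<close>). The automorphism
  sends \<open>x\<^sub>1\<close> to a conjugate \<open>p y p\<inverse>\<close> of a marker generator \<open>y\<close>, where neither \<open>p\<close> nor the images
  of the other generators contain \<open>y\<close>: for \<open>\<sigma>\<^sub>1\<close> take \<open>p = x\<^sub>1\<close>, \<open>y = x\<^sub>2\<close>, for a shifted braid
  take \<open>p = 1\<close>, \<open>y = x\<^sub>1\<close>. Thus markers in the image of a reduced word come only from its letters
  \<open>x\<^sub>1\<^sup>\<plusminus>\<^sup>1\<close>, and two neighbouring markers can cancel only if the image of what lies between them is
  trivial. By injectivity that part of the word is empty, and the word was not reduced. So no
  marker cancels, and everything in front of the first one can be read off.
\<close>

section \<open>Letters of words under multiplication and homomorphisms\<close>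

lemma carrier_F: "w \<in> carrier F \<longleftrightarrow> fst ` set w \<subseteq> {1..} \<and> reduced w"
  by (simp add: F_def free_group_def)

lemma mult_F: "u \<otimes>\<^bsub>F\<^esub> v = foldr cons_red u v"
  by (simp add: F_def free_group_def)

lemma one_F: "\<one>\<^bsub>F\<^esub> = []"
  by (simp add: F_def free_group_def)

lemma inv_F: "w \<in> carrier F \<Longrightarrow> inv\<^bsub>F\<^esub> w = map letter_inv (rev w)"
  by (rule F.inv_equality)
     (auto simp: mult_F one_F foldr_cons_red_inverse carrier_F reduced_inverse image_subset_iff)

lemma avoid_mult:
  "y \<notin> fst ` set u \<Longrightarrow> y \<notin> fst ` set v \<Longrightarrow> y \<notin> fst ` set (u \<otimes>\<^bsub>F\<^esub> v)"
  using letters_foldr[of u v] unfolding mult_F by blast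

lemma avoid_inv:
  "u \<in> carrier F \<Longrightarrow> y \<notin> fst ` set u \<Longrightarrow> y \<notin> fst ` set (inv\<^bsub>F\<^esub> u)"
  by (simp add: inv_F image_image)

lemma letter_F:
  assumes "fst a \<ge> 1"
  shows "[a] = (if snd a then free_gen (fst a) else inv\<^bsub>F\<^esub> (free_gen (fst a)))"
  using assms inv_free_gen[of "fst a" "{1..}"] by (cases a) (auto simp: F_def free_gen_def)

lemma Cons_F:
  assumes "a # w \<in> carrier F"
  shows "a # w = [a] \<otimes>\<^bsub>F\<^esub> w" "[a] \<in> carrier F" "w \<in> carrier F" "fst a \<ge> 1"
  using assms by (auto simp: carrier_F mult_F cons_red_reduced reduced_Cons)

lemma hom_letter_F:
  assumes "\<phi> \<in> hom F F" "fst a \<ge> 1"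
  shows "\<phi> [a] = (if snd a then \<phi> (free_gen (fst a)) else inv\<^bsub>F\<^esub> (\<phi> (free_gen (fst a))))"
proof -
  interpret group_hom F F \<phi>
    using assms(1) by (simp add: group_hom_def group_hom_axioms_def)
  show ?thesis using assms(2) by (simp add: letter_F)
qed

lemma hom_avoid:
  assumes \<phi>: "\<phi> \<in> hom F F"
    and gens: "\<And>j. j \<ge> 1 \<Longrightarrow> j \<in> J \<Longrightarrow> y \<notin> fst ` set (\<phi> (free_gen j))"
    and w: "w \<in> carrier F" "fst ` set w \<subseteq> J"
  shows "y \<notin> fst ` set (\<phi> w)"
  using w
proof (induction w)
  case Nil
  interpret group_hom F F \<phi>
    using \<phi> by (simp add: group_hom_def group_hom_axioms_def)
  show ?case using hom_one by (simp add: one_F)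
next
  case (Cons a w)
  note aw = Cons_F[OF Cons.prems(1)]
  have "\<phi> (a # w) = \<phi> [a] \<otimes>\<^bsub>F\<^esub> \<phi> w"
    using aw \<phi> by (metis hom_mult)
  moreover have "y \<notin> fst ` set (\<phi> [a])"
    using gens[OF aw(4)] Cons.prems(2) hom_in_carrier[OF \<phi> free_gen_F[OF aw(4)]]
      avoid_inv[of "\<phi> (free_gen (fst a))" y]
    unfolding hom_letter_F[OF \<phi> aw(4)] by auto
  ultimately show ?case
    using Cons.IH[OF aw(3)] Cons.prems(2) avoid_mult by auto
qed

text \<open>
  A letter \<open>c\<close> shields what follows it: a left factor without \<open>c\<close> cannot cancel beyond it.
\<close>

lemma mult_append_avoid:
  assumes "fst c \<notin> fst ` set u"
  shows "u \<otimes>\<^bsub>F\<^esub> (v @ c # q) = (u \<otimes>\<^bsub>F\<^esub> v) @ c # q"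
proof -
  have step: "cons_red a (z @ c # q) = cons_red a z @ c # q" if "fst c \<noteq> fst a" for a z
    using that by (cases z) auto
  show ?thesis using assms unfolding mult_F by (induction u) (auto simp: step)
qed

section \<open>Markers do not cancel\<close>

text \<open>
  The prefix \<open>h\<close> stays arbitrary because the recursion applies to the word after \<open>a\<close>, whose own
  first \<open>x\<close>-letter may be further inside; the exact form \<open>\<phi> h \<cdot> p\<close> of what precedes the marker is
  what lets injectivity detect a cancellation.
\<close>

lemma first_marker:
  assumes \<phi>: "\<phi> \<in> hom F F" and inj: "inj_on \<phi> (carrier F)"
    and p: "p \<in> carrier F" "y \<notin> fst ` set p"
    and y: "y \<ge> 1"
    and x: "\<phi> (free_gen x) = p \<otimes>\<^bsub>F\<^esub> free_gen y \<otimes>\<^bsub>F\<^esub> inv\<^bsub>F\<^esub> p"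
    and others: "\<And>j. j \<ge> 1 \<Longrightarrow> j \<noteq> x \<Longrightarrow> y \<notin> fst ` set (\<phi> (free_gen j))"
    and w: "h @ a # r \<in> carrier F" "x \<notin> fst ` set h" "fst a = x"
  shows "\<exists>q. \<phi> (h @ a # r) = (\<phi> h \<otimes>\<^bsub>F\<^esub> p) @ (y, snd a) # q"
proof -
  interpret \<phi>: group_hom F F \<phi>
    using \<phi> by (simp add: group_hom_def group_hom_axioms_def)
  have avoid: "y \<notin> fst ` set (\<phi> v)" if "v \<in> carrier F" "x \<notin> fst ` set v" for v
    by (rule hom_avoid[OF \<phi> _ that(1), of "- {x}"]) (use others that(2) in auto)
  have ip: "inv\<^bsub>F\<^esub> p \<in> carrier F" "y \<notin> fst ` set (inv\<^bsub>F\<^esub> p)"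
    using p by (auto intro: avoid_inv[THEN notE])
  have image_letter: "\<phi> [c] = p \<otimes>\<^bsub>F\<^esub> [(y, snd c)] \<otimes>\<^bsub>F\<^esub> inv\<^bsub>F\<^esub> p" if "fst c = x" "x \<ge> 1" for c
  proof -
    have "inv\<^bsub>F\<^esub> (\<phi> (free_gen x)) = p \<otimes>\<^bsub>F\<^esub> inv\<^bsub>F\<^esub> (free_gen y) \<otimes>\<^bsub>F\<^esub> inv\<^bsub>F\<^esub> p"
      using p y by (simp add: x F.inv_mult_group F.m_assoc)
    then show ?thesis
      using hom_letter_F[OF \<phi>, of c] letter_F[of "(y, snd c)"] that x y by simp
  qed
  define w where "w = h @ a # r"
  then have "w \<in> carrier F" using assms by simp
  then show ?thesis
    unfolding w_def[symmetric] using w_def w(2,3)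
  proof (induction w arbitrary: h a r)
    case (Cons b w)
    note bw = Cons_F[OF Cons.prems(1)]
    have \<phi>bw: "\<phi> (b # w) = \<phi> [b] \<otimes>\<^bsub>F\<^esub> \<phi> w"
      using bw \<phi> by (metis hom_mult)
    show ?case
    proof (cases h)
      case (Cons c h')
      then have h: "h = b # h'" and w: "w = h' @ a # r" using Cons.prems(2) by auto
      have b: "fst b \<noteq> x" and h': "x \<notin> fst ` set h'" using Cons.prems(3) h by auto
      have "h \<in> carrier F"
        using Cons.prems(1) unfolding Cons.prems(2)
        by (auto simp: carrier_F reduced_def successively_append_iff)
      note bh = Cons_F[OF this[unfolded h]]
      obtain q where q: "\<phi> w = (\<phi> h' \<otimes>\<^bsub>F\<^esub> p) @ (y, snd a) # q"
        using Cons.IH[OF bw(3) w h' Cons.prems(4)] by blast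
      have "y \<notin> fst ` set (\<phi> [b])"
        using b by (intro avoid[OF bw(2)]) auto
      then have "\<phi> (b # w) = (\<phi> [b] \<otimes>\<^bsub>F\<^esub> (\<phi> h' \<otimes>\<^bsub>F\<^esub> p)) @ (y, snd a) # q"
        unfolding \<phi>bw q by (intro mult_append_avoid) simp
      moreover have "\<phi> h = \<phi> [b] \<otimes>\<^bsub>F\<^esub> \<phi> h'"
        using bh \<phi> unfolding h by (metis hom_mult)
      ultimately show ?thesis
        using bh p by (auto simp: F.m_assoc)
    next
      case Nil
      then have ba: "b = a" and w: "w = r" using Cons.prems(2) by auto
      define z where "z = inv\<^bsub>F\<^esub> p \<otimes>\<^bsub>F\<^esub> \<phi> w"
      have z: "z \<in> carrier F" using ip bw(3) by (simp add: z_def)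
      have ya: "[(y, snd a)] \<in> carrier F" using y by (simp add: carrier_F)
      have \<phi>z: "\<phi> (b # w) = p \<otimes>\<^bsub>F\<^esub> ([(y, snd a)] \<otimes>\<^bsub>F\<^esub> z)"
        unfolding \<phi>bw z_def using image_letter[of b] bw Cons.prems(4) p ip ya
        by (simp add: ba F.m_assoc)
      have "[(y, snd a)] \<otimes>\<^bsub>F\<^esub> z = (y, snd a) # z"
      proof (cases "x \<in> fst ` set w")
        case False
        then have "y \<notin> fst ` set z"
          unfolding z_def by (intro avoid_mult ip avoid[OF bw(3)])
        then show ?thesis
          by (cases z) (auto simp: mult_F letter_inv_def)
      next
        case True
        then obtain h' a' r' where w': "w = h' @ a' # r'" "fst a' = x" "x \<notin> fst ` set h'"
          using split_list_first_prop[of w "\<lambda>a. fst a = x"] by (metis (no_types, lifting) imageE)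
        have h': "h' \<in> carrier F"
          using bw(3) unfolding w'(1) by (auto simp: carrier_F reduced_def successively_append_iff)
        obtain q where q: "\<phi> w = (\<phi> h' \<otimes>\<^bsub>F\<^esub> p) @ (y, snd a') # q"
          using Cons.IH[OF bw(3) w'(1,3,2)] by blast
        define g where "g = inv\<^bsub>F\<^esub> p \<otimes>\<^bsub>F\<^esub> (\<phi> h' \<otimes>\<^bsub>F\<^esub> p)"
        have zg: "z = g @ (y, snd a') # q"
          unfolding z_def q g_def using ip by (intro mult_append_avoid) simp
        have "y \<notin> fst ` set g"
          unfolding g_def by (intro avoid_mult ip p avoid[OF h' w'(3)])
        moreover have "snd a' = snd a" if "g = []"
        proof -
          \<comment> \<open>\<open>g\<close> is a conjugate of \<open>\<phi> h'\<close>, so here the two markers come from adjacent letters.\<close>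
          have "p \<otimes>\<^bsub>F\<^esub> g \<otimes>\<^bsub>F\<^esub> inv\<^bsub>F\<^esub> p = \<phi> h'"
            using p ip h' by (simp add: g_def F.m_assoc[symmetric]) (simp add: F.m_assoc)
          moreover have "p \<otimes>\<^bsub>F\<^esub> g \<otimes>\<^bsub>F\<^esub> inv\<^bsub>F\<^esub> p = \<one>\<^bsub>F\<^esub>"
            unfolding that one_F[symmetric] using p by simp
          ultimately have "\<phi> h' = \<phi> \<one>\<^bsub>F\<^esub>"
            by (metis \<phi>.hom_one)
          then have "h' = []"
            using inj_onD[OF inj _ h'] by (simp add: one_F[symmetric])
          then show ?thesis
            using Cons.prems(1,4) w' ba
            by (auto simp: carrier_F reduced_Cons letter_inv_def prod_eq_iff)
        qed
        ultimately show ?thesis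
          by (cases g) (auto simp: mult_F zg letter_inv_def)
      qed
      then have "\<phi> (b # w) = p \<otimes>\<^bsub>F\<^esub> ([] @ (y, snd a) # z)"
        using \<phi>z by simp
      also have "\<dots> = (p \<otimes>\<^bsub>F\<^esub> \<one>\<^bsub>F\<^esub>) @ (y, snd a) # z"
        unfolding one_F by (rule mult_append_avoid) (use p in simp)
      finally show ?thesis
        using p Nil by (simp add: one_F[symmetric])
    qed
  qed simp
qed

section \<open>The words that start with the first generator\<close>

definition E :: "(nat \<times> bool) list set" where
  "E = {w \<in> carrier F. \<exists>u. w = (1, True) # u}"

lemma auto_inj: "\<phi> \<in> auto F \<Longrightarrow> inj_on \<phi> (carrier F)"
  by (auto simp: auto_def Bij_def bij_betw_def)

text \<open>
  By \<open>first_marker\<close> the image of a word in \<open>E\<close> starts with \<open>p\<close> followed by the marker.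
\<close>

lemma E_stable:
  assumes \<phi>: "\<phi> \<in> auto F"
    and p: "p \<in> carrier F" "y \<notin> fst ` set p" "y \<ge> 1"
    and x: "\<phi> (free_gen 1) = p \<otimes>\<^bsub>F\<^esub> free_gen y \<otimes>\<^bsub>F\<^esub> inv\<^bsub>F\<^esub> p"
    and others: "\<And>j. j \<ge> 2 \<Longrightarrow> y \<notin> fst ` set (\<phi> (free_gen j))"
    and start: "hd (p @ [(y, True)]) = (1, True)"
    and w: "w \<in> E"
  shows "\<phi> w \<in> E"
proof -
  from w obtain u where u: "w = (1, True) # u" "w \<in> carrier F" by (auto simp: E_def)
  have "\<exists>q. \<phi> ([] @ (1, True) # u) = (\<phi> [] \<otimes>\<^bsub>F\<^esub> p) @ (y, snd (1::nat, True)) # q"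
    by (rule first_marker[where x = 1])
       (use auto_hom[OF \<phi>] auto_inj[OF \<phi>] p x others u in auto)
  moreover have "\<phi> [] = \<one>\<^bsub>F\<^esub>"
    using hom_one[OF auto_hom[OF \<phi>]] F.is_group by (simp add: one_F)
  ultimately obtain q where q: "\<phi> w = p @ (y, True) # q"
    using p u by auto
  have "\<exists>u. \<phi> w = (1, True) # u"
    using start by (cases p) (auto simp: q)
  then show ?thesis
    using auto_closed[OF \<phi> u(2)] by (simp add: E_def)
qed

lemma sigma_1_E: "w \<in> E \<Longrightarrow> sigma 1 w \<in> E"
proof (rule E_stable[where \<phi> = "sigma 1" and p = "free_gen 1" and y = 2])
  show "sigma 1 (free_gen 1) = free_gen 1 \<otimes>\<^bsub>F\<^esub> free_gen 2 \<otimes>\<^bsub>F\<^esub> inv\<^bsub>F\<^esub> (free_gen 1)"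
    using sigma_gen(1)[of 1] by (simp add: numeral_2_eq_2)
  show "2 \<notin> fst ` set (sigma 1 (free_gen j))" if "j \<ge> 2" for j
    using that sigma_gen(2)[of 1] sigma_gen(3)[of 1 j] by (cases "j = 2") (auto simp: free_gen_def numeral_2_eq_2)
qed (auto simp: sigma_auto free_gen_def[of "Suc 0"] carrier_F)

section \<open>Shifted braids\<close>

definition sh :: "(nat \<times> bool) list \<Rightarrow> (nat \<times> bool) list" where
  "sh = free_lift F (\<lambda>j. free_gen (j + 1))"

lemma sh_hom: "sh \<in> hom F F"
  unfolding sh_def by (rule free_lift_hom_F) auto

lemma sh_gen: "sh (free_gen j) = free_gen (j + 1)"
  by (simp add: sh_def free_lift_gen_F)

lemma sh_avoid: "w \<in> carrier F \<Longrightarrow> 1 \<notin> fst ` set (sh w)"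
  by (rule hom_avoid[OF sh_hom, of UNIV]) (auto simp: sh_gen, simp add: free_gen_def)

lemma one_B_apply: "w \<in> carrier F \<Longrightarrow> \<one>\<^bsub>B\<^esub> w = w"
  by (simp add: B_def one_AutoGroup)

lemma mult_B_apply:
  "\<gamma> \<in> carrier B \<Longrightarrow> \<delta> \<in> carrier B \<Longrightarrow> w \<in> carrier F \<Longrightarrow> (\<gamma> \<otimes>\<^bsub>B\<^esub> \<delta>) w = \<gamma> (\<delta> w)"
  by (simp add: mult_B compose_eq)

text \<open>
  The endomorphism \<open>sh\<close> maps onto the words without \<open>x\<^sub>1\<close>, so intertwining it shows that these words
  form an invariant subgroup. Mere invariance would not pass to inverses in the induction over
  products of generators; the intertwining relation does.
\<close>

lemma shift_action:
  assumes "\<gamma> \<in> carrier B"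
  shows "shift \<gamma> (free_gen 1) = free_gen 1 \<and> (\<forall>w\<in>carrier F. shift \<gamma> (sh w) = sh (\<gamma> w))"
proof -
  interpret B: group B by (rule group_B)
  interpret s: group_hom B B shift
    by (simp add: group_hom_def group_hom_axioms_def group_B shift_hom)
  define P where "P = (\<lambda>\<gamma>. \<gamma> \<in> carrier B \<and> shift \<gamma> (free_gen 1) = free_gen 1 \<and>
    (\<forall>w\<in>carrier F. shift \<gamma> (sh w) = sh (\<gamma> w)))"
  have closed: "\<gamma> w \<in> carrier F" if "\<gamma> \<in> carrier B" "w \<in> carrier F" for \<gamma> w
    using auto_closed that carrier_B_subset by blast
  have shc: "sh w \<in> carrier F" if "w \<in> carrier F" for w
    using hom_in_carrier[OF sh_hom that] .
  have gen: "P (sigma i)" if i: "i \<ge> 1" for i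
  proof -
    have "(sigma (i + 1) \<circ> sh) w = (sh \<circ> sigma i) w" if "w \<in> carrier F" for w
    proof (rule F_hom_eq[OF _ _ _ that])
      show "sigma (i + 1) \<circ> sh \<in> hom F F"
        using sh_hom sigma_hom by (rule Group.hom_compose) simp
      show "sh \<circ> sigma i \<in> hom F F"
        using sigma_hom[OF i] sh_hom by (rule Group.hom_compose)
      interpret sh: group_hom F F sh
        by (simp add: group_hom_def group_hom_axioms_def sh_hom)
      fix j :: nat assume "j \<ge> 1"
      consider "j = i" | "j = i + 1" | "j \<noteq> i" "j \<noteq> i + 1" by blast
      then show "(sigma (i + 1) \<circ> sh) (free_gen j) = (sh \<circ> sigma i) (free_gen j)"
        by cases (use i \<open>j \<ge> 1\<close> sigma_gen[OF i] sigma_gen[of "i + 1"] in \<open>auto simp: sh_gen\<close>)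
    qed
    then show ?thesis
      using i sigma_gen(3)[of "i + 1" 1] by (auto simp: P_def sigma_in_B shift_sigma)
  qed
  have mult: "P (\<gamma> \<otimes>\<^bsub>B\<^esub> \<delta>)" if "P \<gamma>" "P \<delta>" for \<gamma> \<delta>
    using that by (auto simp: P_def mult_B_apply closed shc)
  have inv: "P (inv\<^bsub>B\<^esub> \<gamma>)" if "P \<gamma>" for \<gamma>
  proof -
    have \<gamma>: "\<gamma> \<in> carrier B" and i: "inv\<^bsub>B\<^esub> \<gamma> \<in> carrier B"
      using that by (auto simp: P_def)
    have cancel: "shift (inv\<^bsub>B\<^esub> \<gamma>) (shift \<gamma> w) = w" if "w \<in> carrier F" for w
      using mult_B_apply[of "shift (inv\<^bsub>B\<^esub> \<gamma>)" "shift \<gamma>" w] \<gamma> that by (simp add: one_B_apply)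
    have cancel': "\<gamma> ((inv\<^bsub>B\<^esub> \<gamma>) w) = w" if "w \<in> carrier F" for w
      using mult_B_apply[of \<gamma> "inv\<^bsub>B\<^esub> \<gamma>" w] \<gamma> that by (simp add: one_B_apply)
    have "shift (inv\<^bsub>B\<^esub> \<gamma>) (free_gen 1) = free_gen 1"
      using cancel[of "free_gen 1"] that by (simp add: P_def)
    moreover have "shift (inv\<^bsub>B\<^esub> \<gamma>) (sh w) = sh ((inv\<^bsub>B\<^esub> \<gamma>) w)" if w: "w \<in> carrier F" for w
    proof -
      have "shift \<gamma> (sh ((inv\<^bsub>B\<^esub> \<gamma>) w)) = sh w"
        using \<open>P \<gamma>\<close> closed[OF i w] cancel'[OF w] by (simp add: P_def)
      then show ?thesis
        using cancel[OF shc[OF closed[OF i w]]] by simp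
    qed
    ultimately show ?thesis using i by (simp add: P_def)
  qed
  have one: "P \<one>\<^bsub>B\<^esub>"
    by (simp add: P_def one_B_apply shc)
  from assms have "\<gamma> \<in> generate (AutoGroup F) (sigma ` {1..})" by (simp add: carrier_B)
  then have "P \<gamma>"
  proof induction
    case one
    then show ?case using \<open>P \<one>\<^bsub>B\<^esub>\<close> by (simp add: B_def)
  next
    case (incl \<gamma>)
    then show ?case using gen by auto
  next
    case (inv \<gamma>)
    then have P: "P \<gamma>" using gen by auto
    then have "inv\<^bsub>B\<^esub> \<gamma> = inv\<^bsub>AutoGroup F\<^esub> \<gamma>"
      unfolding P_def B_def by (intro A.inv_subgroup_generated) simp
    then show ?case using \<open>P \<gamma> \<Longrightarrow> P (inv\<^bsub>B\<^esub> \<gamma>)\<close>[OF P] by simp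
  next
    case (eng \<gamma> \<delta>)
    then show ?case using mult by (simp add: mult_B_AutoGroup)
  qed
  then show ?thesis by (simp add: P_def)
qed

lemma shift_closed: "\<gamma> \<in> carrier B \<Longrightarrow> shift \<gamma> \<in> carrier B"
  by (rule hom_in_carrier[OF shift_hom])

lemma shift_auto: "\<gamma> \<in> carrier B \<Longrightarrow> shift \<gamma> \<in> auto F"
  using shift_closed carrier_B_subset by blast

lemma shift_E:
  assumes \<gamma>: "\<gamma> \<in> carrier B" and w: "w \<in> E"
  shows "shift \<gamma> w \<in> E"
proof (rule E_stable[where p = "\<one>\<^bsub>F\<^esub>" and y = 1, OF shift_auto[OF \<gamma>]])
  show "shift \<gamma> (free_gen 1) = \<one>\<^bsub>F\<^esub> \<otimes>\<^bsub>F\<^esub> free_gen 1 \<otimes>\<^bsub>F\<^esub> inv\<^bsub>F\<^esub> \<one>\<^bsub>F\<^esub>"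
    using shift_action[OF \<gamma>] by simp
  show "1 \<notin> fst ` set (shift \<gamma> (free_gen j))" if "j \<ge> 2" for j
  proof -
    have j: "j - 1 \<ge> 1" "free_gen (j - 1 + 1) = free_gen j" using that by auto
    then have "shift \<gamma> (free_gen j) = sh (\<gamma> (free_gen (j - 1)))"
      using shift_action[OF \<gamma>] sh_gen[of "j - 1"] free_gen_F[of "j - 1"] by metis
    then show ?thesis
      using sh_avoid auto_closed[OF subsetD[OF carrier_B_subset \<gamma>] free_gen_F[OF j(1)]] by simp
  qed
  show "1 \<notin> fst ` set \<one>\<^bsub>F\<^esub>" "hd (\<one>\<^bsub>F\<^esub> @ [(1, True)]) = (1, True)"
    by (simp_all add: one_F)
qed (use w in auto)

section \<open>Iterated right multiples\<close>

text \<open>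
  The inverse serves as the witness because \<open>x\<^sub>1\<close> itself already lies in \<open>E\<close>.
\<close>

definition x1_inv :: "(nat \<times> bool) list" where
  "x1_inv = [(1, False)]"

lemma x1_inv_F: "x1_inv \<in> carrier F"
  by (simp add: x1_inv_def carrier_F)

lemma x1_inv_not_E: "x1_inv \<notin> E"
  by (simp add: x1_inv_def E_def)

text \<open>
  These braids include the products that contain \<open>\<sigma>\<^sub>1\<close> at least once, its inverse never, and
  otherwise only shifted braids.
  Stability of \<open>E\<close> is part of the condition because it makes the set closed under products.
\<close>

definition positive :: "((nat \<times> bool) list \<Rightarrow> (nat \<times> bool) list) set" where
  "positive = {\<pi> \<in> carrier B. \<pi> x1_inv \<in> E \<and> \<pi> ` E \<subseteq> E}"

lemma E_F: "w \<in> E \<Longrightarrow> w \<in> carrier F"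
  by (simp add: E_def)

lemma positive_mult:
  assumes "\<pi> \<in> positive" "\<rho> \<in> positive"
  shows "\<pi> \<otimes>\<^bsub>B\<^esub> \<rho> \<in> positive"
proof -
  interpret B: group B by (rule group_B)
  have "\<pi> \<otimes>\<^bsub>B\<^esub> \<rho> \<in> carrier B"
    using assms by (simp add: positive_def)
  then show ?thesis
    using assms x1_inv_F E_F unfolding positive_def by (auto simp: mult_B_apply image_subset_iff)
qed

lemma one_not_positive: "\<one>\<^bsub>B\<^esub> \<notin> positive"
  using x1_inv_not_E by (simp add: positive_def one_B_apply x1_inv_F)

lemma shift_sigma_shift_positive:
  assumes \<gamma>: "\<gamma> \<in> carrier B" and \<delta>: "\<delta> \<in> carrier B"
  shows "shift \<gamma> \<otimes>\<^bsub>B\<^esub> sigma 1 \<otimes>\<^bsub>B\<^esub> shift \<delta> \<in> positive"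
proof -
  interpret B: group B by (rule group_B)
  note [simp] = shift_closed[OF \<gamma>] shift_closed[OF \<delta>] sigma_in_B[of 1, simplified]
  have app: "(shift \<gamma> \<otimes>\<^bsub>B\<^esub> sigma 1 \<otimes>\<^bsub>B\<^esub> shift \<delta>) w = shift \<gamma> (sigma 1 (shift \<delta> w))"
    if "w \<in> carrier F" for w
    using that auto_closed[OF shift_auto[OF \<delta>] that] by (simp add: mult_B_apply)
  have "shift \<delta> x1_inv = x1_inv"
    using hom_letter_F[OF auto_hom[OF shift_auto[OF \<delta>]], of "(1, False)"]
      letter_F[of "(1, False)"] shift_action[OF \<delta>] by (simp add: x1_inv_def)
  moreover have "sigma 1 x1_inv \<in> E"
  proof -
    have "sigma 1 x1_inv
        = inv\<^bsub>F\<^esub> (free_gen 1 \<otimes>\<^bsub>F\<^esub> free_gen (1 + 1) \<otimes>\<^bsub>F\<^esub> inv\<^bsub>F\<^esub> (free_gen 1))"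
      using hom_letter_F[OF sigma_hom, of 1 "(1, False)"] sigma_gen(1)[of 1] by (simp add: x1_inv_def)
    also have "\<dots> = [(1, True), (2, False), (1, False)]"
      by (simp add: inv_F carrier_F mult_F free_gen_def letter_inv_def reduced_def)
    finally show ?thesis
      by (simp add: E_def carrier_F reduced_def letter_inv_def)
  qed
  moreover have "shift \<gamma> \<otimes>\<^bsub>B\<^esub> sigma 1 \<otimes>\<^bsub>B\<^esub> shift \<delta> \<in> carrier B"
    by simp
  ultimately show ?thesis
    using x1_inv_F E_F shift_E[OF \<gamma>] shift_E[OF \<delta>] sigma_1_E
    by (auto simp: positive_def app simp del: One_nat_def)
qed

lemma star_right_multiple:
  assumes "\<alpha> \<in> carrier B" "\<beta> \<in> carrier B"
  obtains \<pi> where "\<pi> \<in> positive" "\<alpha> \<star> \<beta> = \<alpha> \<otimes>\<^bsub>B\<^esub> \<pi>"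
proof -
  interpret B: group B by (rule group_B)
  show ?thesis
    using assms that[OF shift_sigma_shift_positive[of \<beta> "inv\<^bsub>B\<^esub> \<alpha>"]]
    by (simp add: braid_star_def B.m_assoc shift_closed sigma_in_B)
qed

lemma foldl_star_right_multiple:
  assumes "\<alpha> \<in> carrier B" "set \<beta>s \<subseteq> carrier B" "\<beta>s \<noteq> []"
  shows "\<exists>\<pi>\<in>positive. foldl (\<star>) \<alpha> \<beta>s = \<alpha> \<otimes>\<^bsub>B\<^esub> \<pi>"
proof -
  interpret B: group B by (rule group_B)
  have pos: "\<pi> \<in> carrier B" if "\<pi> \<in> positive" for \<pi>
    using that by (simp add: positive_def)
  from assms(3,1,2) show ?thesis
  proof (induction \<beta>s arbitrary: \<alpha> rule: list_nonempty_induct)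
    case (single \<beta>)
    then show ?case by (auto elim: star_right_multiple)
  next
    case (cons \<beta> \<beta>s)
    then obtain \<pi> where \<pi>: "\<pi> \<in> positive" "\<alpha> \<star> \<beta> = \<alpha> \<otimes>\<^bsub>B\<^esub> \<pi>"
      by (auto elim: star_right_multiple)
    with cons obtain \<rho> where "\<rho> \<in> positive" "foldl (\<star>) (\<alpha> \<star> \<beta>) \<beta>s = \<alpha> \<otimes>\<^bsub>B\<^esub> \<pi> \<otimes>\<^bsub>B\<^esub> \<rho>"
      using pos by (metis B.m_closed insert_subset list.simps(15))
    with \<pi> cons.prems show ?case
      using pos positive_mult by (intro bexI[of _ "\<pi> \<otimes>\<^bsub>B\<^esub> \<rho>"]) (auto simp: B.m_assoc)
  qed
qed

theorem mainTheorem1: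
  fixes k :: nat
    and \<alpha> :: "(nat \<times> bool) list \<Rightarrow> (nat \<times> bool) list"
    and \<beta> :: "nat \<Rightarrow> (nat \<times> bool) list \<Rightarrow> (nat \<times> bool) list"
  assumes "k \<ge> 1"
    and "\<alpha> \<in> carrier B"
    and "\<And>i. i \<in> {1..k} \<Longrightarrow> \<beta> i \<in> carrier B"
  shows "\<alpha> \<noteq> foldl (\<star>) \<alpha> (map \<beta> [1..<k + 1])"
proof
  interpret B: group B by (rule group_B)
  assume eq: "\<alpha> = foldl (\<star>) \<alpha> (map \<beta> [1..<k + 1])"
  have "set (map \<beta> [1..<k + 1]) \<subseteq> carrier B" "map \<beta> [1..<k + 1] \<noteq> []"
    using assms(1,3) by auto
  then obtain \<pi> where \<pi>: "\<pi> \<in> positive" "\<alpha> = \<alpha> \<otimes>\<^bsub>B\<^esub> \<pi>"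
    using foldl_star_right_multiple[OF assms(2)] eq by metis
  then have "\<pi> = \<one>\<^bsub>B\<^esub>"
    using assms(2) B.r_cancel_one' by (simp add: positive_def)
  then show False
    using \<pi>(1) one_not_positive by simp
qed

end
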